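(* For all integers $n,k\ge 0$, $$\int_{\mathbb{Z}_p} B_{k,n}(x,q)\,d\mu_q(x)=\sum_{l=0}^{n-k}\binom{n-k}{l}\binom{n}{k}(-1)^l\,\beta_{l+k,q},$$ where $\beta_{l+k,q}$ is the $(l+k)$-th Carlitz $q$-Bernoulli number.
   Context: Let $p$ be a fixed prime, $\mathbb{Z}_p$ the $p$-adic integers, and $\mathbb{C}_p$ the completion of an algebraic closure of $\mathbb{Q}_p$, with $|p|_p=1/p$. Let $q\in\mathbb{C}_p$ with $|1-q|_p<1$, $q$ not a root of unity (in particular $q\neq1$). For $x\in\mathbb{Z}_p$, $q^x$ denotes the continuous extension of $m\mapsto q^m$, and $[x]_q=\frac{1-q^x}{1-q}$, $[x]_{1/q}=\frac{1-q^{-x}}{1-q^{-1}}$. Kim's $q$-Bernstein polynomials on $\mathbb{Z}_p$: $B_{k,n}(x,q)=\binom{n}{k}[x]_q^k\,[1-x]_{1/q}^{\,n-k}$, where $\binom nk$ is the ordinary binomial coefficient (so $B_{k,n}=0$ and the sum over $0\le l\le n-k$ is empty when $k>n$). The $p$-adic $q$-integral is $\int_{\mathbb{Z}_p}f(x)\,d\mu_q(x)=\lim_{N\to\infty}\frac{1}{[p^N]_q}\sum_{x=0}^{p^N-1}f(x)q^x$. Carlitz's $q$-Bernoulli numbers are $\beta_{n,q}=\int_{\mathbb{Z}_p}[x]_q^n\,d\mu_q(x)$ for $n\ge0$. *)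

theory Defs
  imports "HOL-Analysis.Analysis" "HOL-Computational_Algebra.Polynomial"
begin

text \<open>
  The absolute value of a field with a metric is read off from the metric. The constant \<open>norm\<close> is
  not used: the library constrains it to real normed vector spaces, and here there is no real
  scalar multiplication. That \<open>pabs\<close> is an ultrametric absolute value inducing the metric is
  required by \<open>padic_complex\<close> below.
\<close>

definition pabs :: "'a::{field_char_0,complete_space} \<Rightarrow> real" where
  "pabs x = dist x 0"

text \<open>
  In a complete field whose absolute value restricts to the \<open>p\<close>-adic one on the rationals, the
  topological closure of the rationals is the completion \<open>Q_p\<close>.
\<close>

definition Qp :: "'a::{field_char_0,complete_space} set" where
  "Qp = closure \<rat>"

definition Zp :: "'a::{field_char_0,complete_space} set" where
  "Zp = {x \<in> Qp. pabs x \<le> 1}"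

definition algebraic_over :: "'a::field set \<Rightarrow> 'a \<Rightarrow> bool" where
  "algebraic_over S x \<longleftrightarrow> (\<exists>f. f \<noteq> 0 \<and> (\<forall>i. poly.coeff f i \<in> S) \<and> poly f x = 0)"

definition Qp_bar :: "'a::{field_char_0,complete_space} set" where
  "Qp_bar = {x. algebraic_over Qp x}"

text \<open>
  The predicate says that \<open>'a\<close> is \<open>C_p\<close>, i.e. the completion of an algebraic closure of \<open>Q_p\<close>, with
  the absolute value normalised by \<open>pabs p = 1 / p\<close>: the space is complete (type class), the
  elements \<open>Qp_bar\<close> algebraic over \<open>Q_p\<close> form an algebraically closed field, and \<open>Qp_bar\<close> is dense.
  This determines \<open>'a\<close> up to isometric isomorphism.
\<close>

definition padic_complex :: "nat \<Rightarrow> 'a::{field_char_0,complete_space} itself \<Rightarrow> bool" where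
  "padic_complex p K \<longleftrightarrow>
     prime p \<and>
     (\<forall>x y :: 'a. dist x y = pabs (x - y)) \<and>
     (\<forall>x y :: 'a. pabs (x * y) = pabs x * pabs y) \<and>
     (\<forall>x y :: 'a. pabs (x + y) \<le> max (pabs x) (pabs y)) \<and>
     pabs (of_nat p :: 'a) = 1 / real p \<and>
     (\<forall>f :: 'a poly. degree f > 0 \<and> (\<forall>i. poly.coeff f i \<in> Qp_bar) \<longrightarrow>
        (\<exists>x\<in>Qp_bar. poly f x = 0)) \<and>
     closure (Qp_bar :: 'a set) = UNIV"

text \<open>
  \<open>padic_pow q x\<close> is \<open>q\<close> to the power \<open>x\<close> for \<open>x \<in> Zp\<close>. The extension exists for
  \<open>pabs (1 - q) < 1\<close> and its values on \<open>Zp\<close> are unique, as the naturals are dense in \<open>Zp\<close>; its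
  values outside \<open>Zp\<close> are unspecified.
\<close>

definition padic_pow ::
    "'a::{field_char_0,complete_space} \<Rightarrow> 'a \<Rightarrow> 'a" where
  "padic_pow q = (SOME g. continuous_on Zp g \<and> (\<forall>m::nat. g (of_nat m) = q ^ m))"

definition q_number ::
    "'a::{field_char_0,complete_space} \<Rightarrow> 'a \<Rightarrow> 'a" where
  "q_number q x = (1 - padic_pow q x) / (1 - q)"

text \<open>The number \<open>[x]\<close> with base \<open>1/q\<close>, written in terms of powers of \<open>q\<close>.\<close>

definition q_number_inv ::
    "'a::{field_char_0,complete_space} \<Rightarrow> 'a \<Rightarrow> 'a" where
  "q_number_inv q x = (1 - padic_pow q (- x)) / (1 - inverse q)"

definition q_bernstein ::
    "nat \<Rightarrow> nat \<Rightarrow> 'a::{field_char_0,complete_space} \<Rightarrow> 'a \<Rightarrow> 'a" where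
  "q_bernstein k n x q =
     of_nat (n choose k) * q_number q x ^ k * q_number_inv q (1 - x) ^ (n - k)"

definition q_riemann_sum ::
    "nat \<Rightarrow> 'a::{field_char_0,complete_space} \<Rightarrow> ('a \<Rightarrow> 'a) \<Rightarrow> nat \<Rightarrow> 'a" where
  "q_riemann_sum p q f N =
     1 / q_number q (of_nat (p ^ N)) * (\<Sum>x<p ^ N. f (of_nat x) * q ^ x)"

definition q_integrable ::
    "nat \<Rightarrow> 'a::{field_char_0,complete_space} \<Rightarrow> ('a \<Rightarrow> 'a) \<Rightarrow> bool" where
  "q_integrable p q f \<longleftrightarrow> convergent (q_riemann_sum p q f)"

definition q_integral ::
    "nat \<Rightarrow> 'a::{field_char_0,complete_space} \<Rightarrow> ('a \<Rightarrow> 'a) \<Rightarrow> 'a" where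
  "q_integral p q f = lim (q_riemann_sum p q f)"

definition carlitz_q_bernoulli ::
    "nat \<Rightarrow> 'a::{field_char_0,complete_space} \<Rightarrow> nat \<Rightarrow> 'a" where
  "carlitz_q_bernoulli p q n = q_integral p q (\<lambda>x. q_number q x ^ n)"

end

theory Submission
  imports Defs "HOL-Number_Theory.Cong"
begin

text \<open>
  On the natural numbers \<open>x\<close>, the only points a Riemann sum sees, the two \<open>q\<close>-numbers in the
  Bernstein polynomial are complementary: \<open>[1 - x]\<close> with base \<open>1/q\<close> equals \<open>1 - [x]\<close> with base \<open>q\<close>
  (lemma \<open>q_number_inv_one_minus_of_nat\<close>). So the Bernstein polynomial is
  \<open>(n choose k) [x]^k (1 - [x])^(n-k)\<close>, the binomial theorem makes it a linear combination of the
  powers \<open>[x]^(l+k)\<close>, and the identity follows from the linearity of Riemann sums, provided that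
  each power of \<open>[x]\<close> is \<open>q\<close>-integrable.

  Integrability (lemma \<open>q_integrable_q_number_power\<close>) is an explicit computation. A power of \<open>[x]\<close>
  is a linear combination of the functions \<open>q^(j x)\<close>, whose Riemann sums are quotients of geometric
  sums: with \<open>t = q^(p^N)\<close>,
    \<open>(1 / [p^N]) (\<Sum>x<p^N. q^(j x) q^x) = (1 - q) / (1 - q^(j+1)) (1 + t + ... + t^j)\<close>.
  They converge because \<open>q^(p^N)\<close> tends to \<open>1\<close>, and the denominators are nonzero because \<open>q\<close> is not
  a root of unity.

  All this needs the values of \<open>q^x\<close> for natural \<open>x\<close> and for \<open>x = -1\<close> (which enters through
  \<open>[1 - x]\<close> at \<open>x = 0\<close>). Since \<open>q^x\<close> is chosen among the continuous extensions of \<open>m \<mapsto> q^m\<close> to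
  \<open>Zp\<close>, one has to know that an extension exists (lemma \<open>ex_continuous_extension_power\<close>): the map is
  uniformly continuous for the \<open>p\<close>-adic metric, again because \<open>q^(p^N)\<close> tends to \<open>1\<close>, and the
  naturals are dense in \<open>Zp\<close>. The value at \<open>-1\<close> is then the limit of \<open>q^(p^N - 1)\<close>.
\<close>

lemma power_one_minus_expand:
  "(1 - x :: 'a::comm_ring_1) ^ n = (\<Sum>l\<le>n. of_nat (n choose l) * (- 1) ^ l * x ^ l)"
  using binomial_ring[of "- x" 1 n] by (simp add: power_minus[of x] mult.assoc)

section \<open>Ultrametric absolute values\<close>

locale padic_valued_field =
  fixes p :: nat and K :: "'a::{field_char_0,complete_space} itself"
  assumes prime_p: "prime p"
    and dist_eq_pabs: "dist x y = pabs (x - y :: 'a)"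
    and pabs_mult: "pabs (x * y :: 'a) = pabs x * pabs y"
    and pabs_add_le: "pabs (x + y :: 'a) \<le> max (pabs x) (pabs y)"
    and pabs_p: "pabs (of_nat p :: 'a) = 1 / real p"
begin

lemma pabs_nonneg [simp]: "0 \<le> pabs (x :: 'a)"
  by (simp add: pabs_def)

lemma pabs_eq_0_iff [simp]: "pabs (x :: 'a) = 0 \<longleftrightarrow> x = 0"
  by (simp add: pabs_def)

lemma pabs_0 [simp]: "pabs (0 :: 'a) = 0"
  by simp

lemma pabs_1 [simp]: "pabs (1 :: 'a) = 1"
  using pabs_mult[of 1 1] by simp

lemma pabs_diff_commute: "pabs (x - y :: 'a) = pabs (y - x)"
  by (metis dist_commute dist_eq_pabs)

lemma pabs_minus [simp]: "pabs (- x :: 'a) = pabs x"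
  using pabs_diff_commute[of 0 x] by simp

lemma pabs_diff_le: "pabs (x - y :: 'a) \<le> max (pabs x) (pabs y)"
  using pabs_add_le[of x "- y"] by simp

lemma pabs_power: "pabs (x ^ n :: 'a) = pabs x ^ n"
  by (induction n) (simp_all add: pabs_mult)

lemma pabs_divide: "pabs (x / y :: 'a) = pabs x / pabs y"
proof (cases "y = 0")
  case False
  then have "pabs x = pabs (x / y) * pabs y"
    by (simp flip: pabs_mult)
  with False show ?thesis
    by simp
qed simp

lemma pabs_sum_le:
  assumes "\<And>i. i \<in> A \<Longrightarrow> pabs (f i :: 'a) \<le> c" and "0 \<le> c"
  shows "pabs (sum f A) \<le> c"
  using assms
proof (induction A rule: infinite_finite_induct)
  case (insert i A)
  then show ?case
    using pabs_add_le[of "f i" "sum f A"] by (fastforce simp: max_def split: if_splits)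
qed auto

lemma pabs_of_nat_le_1: "pabs (of_nat m :: 'a) \<le> 1"
proof (induction m)
  case (Suc m)
  then show ?case
    using pabs_add_le[of 1 "of_nat m"] by simp
qed simp

lemma pabs_of_int_le_1: "pabs (of_int z :: 'a) \<le> 1"
  by (cases z) (simp_all add: pabs_of_nat_le_1 del: of_nat_Suc)

subsection \<open>Limits\<close>

text \<open>
  The type classes only make \<open>'a\<close> a metric space and a field; that limits respect the field
  operations comes from the absolute value.
\<close>

lemma tendsto_iff_pabs:
  "(f \<longlongrightarrow> (a :: 'a)) F \<longleftrightarrow> ((\<lambda>x. pabs (f x - a)) \<longlongrightarrow> 0) F"
  by (simp add: tendsto_dist_iff[of f] dist_eq_pabs)

lemma tendsto_by_pabs_le:
  assumes "(h \<longlongrightarrow> 0) F" and "\<And>x. pabs (f x - a :: 'a) \<le> h x"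
  shows "(f \<longlongrightarrow> a) F"
  unfolding tendsto_iff_pabs
  by (rule tendsto_sandwich[OF _ _ tendsto_const assms(1)]) (simp_all add: assms(2))

lemma tendsto_plus:
  assumes "(f \<longlongrightarrow> (a :: 'a)) F" and "(g \<longlongrightarrow> b) F"
  shows "((\<lambda>x. f x + g x) \<longlongrightarrow> a + b) F"
proof (rule tendsto_by_pabs_le)
  show "((\<lambda>x. max (pabs (f x - a)) (pabs (g x - b))) \<longlongrightarrow> 0) F"
    using tendsto_max[OF assms[unfolded tendsto_iff_pabs]] by simp
  show "pabs (f x + g x - (a + b)) \<le> max (pabs (f x - a)) (pabs (g x - b))" for x
    using pabs_add_le[of "f x - a" "g x - b"] by (simp add: algebra_simps)
qed

lemma tendsto_cmult:
  assumes "(f \<longlongrightarrow> (a :: 'a)) F"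
  shows "((\<lambda>x. c * f x) \<longlongrightarrow> c * a) F"
proof -
  have "((\<lambda>x. pabs c * pabs (f x - a)) \<longlongrightarrow> 0) F"
    using tendsto_mult_left[OF assms[unfolded tendsto_iff_pabs], of "pabs c"] by simp
  then show ?thesis
    by (simp add: tendsto_iff_pabs pabs_mult flip: right_diff_distrib)
qed

lemma tendsto_linear_combination:
  assumes "\<And>i. i \<in> A \<Longrightarrow> (f i \<longlongrightarrow> (a i :: 'a)) F"
  shows "((\<lambda>x. \<Sum>i\<in>A. c i * f i x) \<longlongrightarrow> (\<Sum>i\<in>A. c i * a i)) F"
  using assms
  by (induction A rule: infinite_finite_induct) (auto intro!: tendsto_plus tendsto_cmult)

section \<open>The integers inside the p-adic integers\<close>

lemma inverse_p_less_1: "1 / real p < 1"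
  using prime_gt_1_nat[OF prime_p] by simp

lemma inverse_p_power_tendsto_0: "(\<lambda>N. (1 / real p) ^ N) \<longlonglongrightarrow> 0"
  using inverse_p_less_1 by (intro LIMSEQ_realpow_zero) auto

lemma pabs_p_power: "pabs (of_nat (p ^ N) :: 'a) = (1 / real p) ^ N"
  by (simp add: pabs_power pabs_p)

lemma pabs_of_int_le_if_dvd:
  assumes "int p ^ N dvd z"
  shows "pabs (of_int z :: 'a) \<le> (1 / real p) ^ N"
proof -
  from assms obtain u where "z = int p ^ N * u"
    by (rule dvdE)
  then have "pabs (of_int z :: 'a) = (1 / real p) ^ N * pabs (of_int u :: 'a)"
    using pabs_p_power[of N] by (simp add: pabs_mult)
  then show ?thesis
    using pabs_of_int_le_1[of u] by (simp add: mult_left_le)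
qed

text \<open>Bezout: a small \<open>z\<close> prime to \<open>p\<close> would make \<open>1\<close> small.\<close>

lemma pabs_of_int_eq_1:
  assumes "\<not> int p dvd z"
  shows "pabs (of_int z :: 'a) = 1"
proof (rule ccontr)
  assume "pabs (of_int z :: 'a) \<noteq> 1"
  then have small: "pabs (of_int z :: 'a) < 1"
    using pabs_of_int_le_1[of z] by simp
  have "coprime (int p) z"
    using assms prime_p by (intro prime_imp_coprime) auto
  then obtain u v where "u * int p + v * z = 1"
    by (metis bezout_int coprime_imp_gcd_eq_1)
  then have "(of_int u * of_nat p + of_int v * of_int z :: 'a) = 1"
    by (metis of_int_1 of_int_add of_int_mult of_int_of_nat_eq)
  then have "1 \<le> max (pabs (of_int u * of_nat p :: 'a)) (pabs (of_int v * of_int z :: 'a))"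
    using pabs_add_le[of "of_int u * of_nat p" "of_int v * of_int z"] by simp
  moreover have "pabs (of_int u * of_nat p :: 'a) \<le> 1 / real p"
    using pabs_of_int_le_1[of u] by (simp add: pabs_mult pabs_p divide_right_mono)
  moreover have "pabs (of_int v * of_int z :: 'a) \<le> pabs (of_int z :: 'a)"
    using pabs_of_int_le_1[of v] by (simp add: pabs_mult mult_left_le_one_le)
  ultimately show False
    using small inverse_p_less_1 by linarith
qed

lemma dvd_if_pabs_of_int_le:
  assumes "pabs (of_int z :: 'a) \<le> (1 / real p) ^ N"
  shows "int p ^ N dvd z"
  using assms
proof (induction N arbitrary: z)
  case (Suc N)
  have p_pos: "real p > 0"
    using prime_gt_0_nat[OF prime_p] by simp
  have "(1 / real p) ^ Suc N < 1"
    using inverse_p_less_1 by (intro power_Suc_less_one) (use p_pos in auto)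
  with Suc.prems have "pabs (of_int z :: 'a) \<noteq> 1"
    by linarith
  then obtain u where z: "z = int p * u"
    using pabs_of_int_eq_1 by (metis dvdE)
  then have "pabs (of_int u :: 'a) \<le> (1 / real p) ^ N"
    using Suc.prems p_pos by (simp add: pabs_mult pabs_p field_simps)
  then show ?case
    using Suc.IH z by simp
qed simp

lemma of_int_in_Zp: "(of_int z :: 'a) \<in> Zp"
  unfolding Zp_def Qp_def using closure_subset[of \<rat>] pabs_of_int_le_1 by auto

text \<open>
  A point of \<open>Zp\<close> is close to a rational \<open>a / b\<close>, whose absolute value is then at most \<open>1\<close> too.
  So \<open>b\<close> is prime to \<open>p\<close>, and \<open>a / b\<close> is close to any natural number \<open>m\<close> that solves the congruence
  \<open>b m = a\<close> modulo a high power of \<open>p\<close>.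
\<close>

lemma Zp_subset_closure_of_nat: "(Zp :: 'a set) \<subseteq> closure (range of_nat)"
proof
  fix x :: 'a assume "x \<in> Zp"
  then have x: "x \<in> closure \<rat>" "pabs x \<le> 1"
    by (auto simp: Zp_def Qp_def)
  show "x \<in> closure (range of_nat)"
    unfolding closure_approachable
  proof (intro allI impI)
    fix e :: real assume "e > 0"
    then obtain r where r: "r \<in> \<rat>" "dist r x < min e 1"
      using x(1) unfolding closure_approachable by (metis min_less_iff_conj zero_less_one)
    have r_le: "pabs r \<le> 1"
      using pabs_add_le[of "r - x" x] x(2) r(2) by (auto simp: dist_eq_pabs)
    obtain a b :: int where ab: "b > 0" "coprime a b" "r = of_int a / of_int b"
      using r(1) by (rule Rats_cases')
    have b: "\<not> int p dvd b"
    proof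
      assume dvd: "int p dvd b"
      then have "\<not> int p dvd a"
        using ab(2) prime_p by (meson coprime_common_divisor not_prime_unit prime_nat_int_transfer)
      then have "pabs (of_int a :: 'a) = 1"
        by (rule pabs_of_int_eq_1)
      moreover have "pabs (of_int b :: 'a) < 1"
        using pabs_of_int_le_if_dvd[of 1 b] dvd inverse_p_less_1 by simp
      moreover have "pabs (of_int b :: 'a) > 0"
        using ab(1) by (simp add: order_less_le)
      ultimately show False
        using r_le ab(3) by (simp add: pabs_divide)
    qed
    obtain N where N: "(1 / real p) ^ N < e"
      using real_arch_pow_inv[OF \<open>e > 0\<close> inverse_p_less_1] by blast
    have "coprime (int p) b"
      using b prime_p by (intro prime_imp_coprime) auto
    then have "coprime b (int p ^ N)"
      by (simp add: coprime_commute)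
    then obtain y where y: "[b * y = 1] (mod (int p ^ N))"
      using cong_solve_coprime_int by blast
    define m where "m = nat ((y * a) mod int p ^ N)"
    have "int m = (y * a) mod int p ^ N"
      unfolding m_def using prime_gt_0_nat[OF prime_p] by simp
    then have "[int m = y * a] (mod (int p ^ N))"
      by simp
    then have "[b * int m = b * (y * a)] (mod (int p ^ N))"
      by (rule cong_scalar_left)
    moreover have "[b * (y * a) = a] (mod (int p ^ N))"
      using cong_scalar_right[OF y, of a] by (simp add: mult.assoc)
    ultimately have "int p ^ N dvd b * int m - a"
      by (metis cong_iff_dvd_diff cong_trans)
    then have "pabs (of_int (b * int m - a) :: 'a) \<le> (1 / real p) ^ N"
      by (rule pabs_of_int_le_if_dvd)
    moreover have "of_nat m - r = of_int (b * int m - a) / of_int b"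
      using ab by (simp add: field_simps)
    ultimately have "pabs (of_nat m - r) < e"
      using N pabs_of_int_eq_1[OF b] by (simp add: pabs_divide)
    moreover have "pabs (r - x) < e"
      using r(2) by (simp add: dist_eq_pabs)
    ultimately have "dist (of_nat m) x < e"
      using pabs_add_le[of "of_nat m - r" "r - x"] by (simp add: dist_eq_pabs)
    then show "\<exists>y\<in>range of_nat. dist y x < e"
      by blast
  qed
qed

section \<open>Powers of an element close to 1\<close>

lemma pabs_le_1_if_near_1:
  assumes "pabs (1 - t :: 'a) < 1"
  shows "pabs t \<le> 1"
  using pabs_diff_le[of 1 "1 - t"] assms by simp

lemma pabs_power_minus_1_le:
  assumes "pabs (t :: 'a) \<le> 1"
  shows "pabs (t ^ j - 1) \<le> pabs (t - 1)"
proof (induction j)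
  case (Suc j)
  have "t ^ Suc j - 1 = t * (t ^ j - 1) + (t - 1)"
    by (simp add: algebra_simps)
  then have "pabs (t ^ Suc j - 1) \<le> max (pabs (t * (t ^ j - 1))) (pabs (t - 1))"
    by (metis pabs_add_le)
  moreover have "pabs (t * (t ^ j - 1)) \<le> pabs (t ^ j - 1)"
    using assms by (simp add: pabs_mult mult_left_le_one_le)
  ultimately show ?case
    using Suc.IH by linarith
qed simp

text \<open>
  The second factor of \<open>t^p - 1 = (t - 1) (1 + t + ... + t^(p-1))\<close> is congruent to \<open>p\<close> modulo
  \<open>t - 1\<close>, so each \<open>p\<close>-th power brings \<open>t\<close> closer to \<open>1\<close> by a fixed factor.
\<close>

lemma pabs_p_power_minus_1_le:
  assumes "pabs (t - 1 :: 'a) \<le> c" and "1 / real p \<le> c" and "c < 1"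
  shows "pabs (t ^ p - 1) \<le> c * pabs (t - 1)"
proof -
  have t: "pabs t \<le> 1"
    using assms by (intro pabs_le_1_if_near_1) (simp add: pabs_diff_commute)
  have "(\<Sum>i<p. t ^ i) = of_nat p + (\<Sum>i<p. t ^ i - 1)"
    by (simp add: sum_subtractf)
  moreover have "pabs (\<Sum>i<p. t ^ i - 1) \<le> c"
    using assms(1) pabs_power_minus_1_le[OF t]
    by (intro pabs_sum_le) (auto intro: order_trans pabs_nonneg)
  ultimately have "pabs (\<Sum>i<p. t ^ i) \<le> c"
    using pabs_add_le[of "of_nat p" "\<Sum>i<p. t ^ i - 1"] assms(2) by (simp add: pabs_p)
  moreover have "t ^ p - 1 = (t - 1) * (\<Sum>i<p. t ^ i)"
    by (rule power_diff_1_eq)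
  ultimately show ?thesis
    by (simp add: pabs_mult mult.commute[of c] mult_left_mono)
qed

end

locale q_near_1 = padic_valued_field p "TYPE('a)"
  for p :: nat and q :: "'a::{field_char_0,complete_space}" +
  assumes q_near_1: "pabs (1 - q) < 1"
begin

lemma q_nonzero: "q \<noteq> 0"
  using q_near_1 by auto

lemma pabs_q_power_le_1: "pabs (q ^ m) \<le> 1"
  using pabs_le_1_if_near_1[OF q_near_1] by (simp add: pabs_power power_le_one)

lemma q_power_p_power_tendsto_1: "(\<lambda>N. q ^ p ^ N) \<longlonglongrightarrow> 1"
proof -
  define c where "c = max (1 / real p) (pabs (q - 1))"
  have c: "0 \<le> c" "c < 1" "1 / real p \<le> c"
    using q_near_1 inverse_p_less_1 by (auto simp: c_def pabs_diff_commute max_def)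
  have bound: "pabs (q ^ p ^ N - 1) \<le> c ^ Suc N" for N
  proof (induction N)
    case 0
    then show ?case
      by (simp add: c_def)
  next
    case (Suc N)
    have "c ^ Suc N \<le> c"
      using c power_decreasing[of 1 "Suc N" c] by simp
    then have "pabs ((q ^ p ^ N) ^ p - 1) \<le> c * pabs (q ^ p ^ N - 1)"
      using Suc c by (intro pabs_p_power_minus_1_le) auto
    also have "\<dots> \<le> c * c ^ Suc N"
      using Suc c by (intro mult_left_mono) auto
    finally show ?case
      by (simp add: mult.commute flip: power_mult)
  qed
  have "(\<lambda>N. c ^ Suc N) \<longlonglongrightarrow> 0"
    using c by (intro LIMSEQ_Suc LIMSEQ_realpow_zero) auto
  then show ?thesis
    using bound by (rule tendsto_by_pabs_le)
qed

lemma q_power_mult_p_power_tendsto_1: "(\<lambda>N. (q ^ p ^ N) ^ i) \<longlonglongrightarrow> 1"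
  using q_power_p_power_tendsto_1[unfolded tendsto_iff_pabs] pabs_power_minus_1_le[OF pabs_q_power_le_1]
  by (rule tendsto_by_pabs_le)

text \<open>
  For \<open>l \<le> m\<close>, the difference \<open>q^m - q^l\<close> is \<open>q^l (t^j - 1)\<close> with \<open>t = q^(p^N)\<close>. Together with the
  limit of \<open>q^(p^N)\<close> this makes \<open>m \<mapsto> q^m\<close> uniformly continuous in the \<open>p\<close>-adic metric.
\<close>

lemma pabs_q_power_diff_le:
  assumes "int p ^ N dvd int m - int l"
  shows "pabs (q ^ m - q ^ l) \<le> pabs (q ^ p ^ N - 1)"
  using assms
proof (induction l m rule: linorder_wlog)
  case (le l m)
  then have "p ^ N dvd m - l"
    by (metis int_dvd_int_iff int_ops(6) of_nat_diff of_nat_power)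
  then obtain j where "m - l = p ^ N * j"
    by (rule dvdE)
  with le have "m = l + p ^ N * j"
    by simp
  then have "q ^ m - q ^ l = q ^ l * ((q ^ p ^ N) ^ j - 1)"
    by (simp add: power_add power_mult right_diff_distrib)
  then have "pabs (q ^ m - q ^ l) \<le> pabs ((q ^ p ^ N) ^ j - 1)"
    using pabs_q_power_le_1[of l] by (simp add: pabs_mult mult_left_le_one_le)
  also have "\<dots> \<le> pabs (q ^ p ^ N - 1)"
    by (rule pabs_power_minus_1_le[OF pabs_q_power_le_1])
  finally show ?case .
next
  case (sym l m)
  then show ?case
    by (metis dvd_diff_commute pabs_diff_commute)
qed

section \<open>The p-adic power function\<close>

lemma ex_continuous_extension_power:
  "\<exists>g. continuous_on (Zp :: 'a set) g \<and> (\<forall>m. g (of_nat m) = q ^ m)"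
proof -
  \<comment> \<open>The exponent read as a point of the field, where the \<open>p\<close>-adic metric lives.\<close>
  define f :: "'a \<Rightarrow> 'a" where "f x = q ^ inv of_nat x" for x
  have f: "f (of_nat m) = q ^ m" for m
    by (simp add: f_def inv_f_f)
  have "uniformly_continuous_on (range of_nat) f"
    unfolding uniformly_continuous_on_def
  proof (intro allI impI)
    fix e :: real assume "e > 0"
    then obtain N where N: "pabs (q ^ p ^ N - 1) < e"
      using q_power_p_power_tendsto_1
      by (auto simp: lim_sequentially dist_eq_pabs)
    have "dist (f y) (f x) < e"
      if "x \<in> range of_nat" "y \<in> range of_nat" "dist y x < (1 / real p) ^ N" for x y
    proof -
      obtain l m where lm: "x = of_nat l" "y = of_nat m"
        using \<open>x \<in> range of_nat\<close> \<open>y \<in> range of_nat\<close> by blast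
      have "pabs (of_int (int m - int l) :: 'a) \<le> (1 / real p) ^ N"
        using that(3) lm by (simp add: dist_eq_pabs)
      then have "pabs (q ^ m - q ^ l) \<le> pabs (q ^ p ^ N - 1)"
        by (intro pabs_q_power_diff_le dvd_if_pabs_of_int_le)
      with N show ?thesis
        by (simp add: lm f dist_eq_pabs)
    qed
    moreover have "(1 / real p) ^ N > 0"
      using prime_gt_0_nat[OF prime_p] by simp
    ultimately show "\<exists>d>0. \<forall>x\<in>range of_nat. \<forall>y\<in>range of_nat. dist y x < d \<longrightarrow> dist (f y) (f x) < e"
      by blast
  qed
  then obtain g where g: "uniformly_continuous_on (closure (range of_nat)) g"
      "\<And>x. x \<in> range of_nat \<Longrightarrow> f x = g x"
    by (rule uniformly_continuous_on_extension_on_closure) blast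
  have "continuous_on Zp g"
    using uniformly_continuous_imp_continuous[OF g(1)] Zp_subset_closure_of_nat
    by (rule continuous_on_subset)
  moreover have "g (of_nat m) = q ^ m" for m
    using g(2)[of "of_nat m"] f by simp
  ultimately show ?thesis
    by blast
qed

lemma continuous_on_padic_pow: "continuous_on Zp (padic_pow q)"
  and padic_pow_of_nat: "padic_pow q (of_nat m) = q ^ m"
  using someI_ex[OF ex_continuous_extension_power] by (auto simp: padic_pow_def)

text \<open>
  The naturals \<open>p^N - 1\<close> tend to \<open>-1\<close>, and their powers are \<open>q^(p^N) / q\<close>.
\<close>

lemma padic_pow_minus_1: "padic_pow q (- 1) = inverse q"
proof (rule LIMSEQ_unique)
  have p_power: "p ^ N \<ge> 1" for N
    using prime_gt_0_nat[OF prime_p] by simp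
  have "(\<lambda>N. of_nat (p ^ N - 1) :: 'a) \<longlonglongrightarrow> - 1"
    using inverse_p_power_tendsto_0
  proof (rule tendsto_by_pabs_le)
    show "pabs (of_nat (p ^ N - 1) - (- 1) :: 'a) \<le> (1 / real p) ^ N" for N
      by (simp only: of_nat_diff[OF p_power] pabs_p_power of_nat_1 diff_minus_eq_add diff_add_cancel
          order_refl)
  qed
  then have "(\<lambda>N. padic_pow q (of_nat (p ^ N - 1))) \<longlonglongrightarrow> padic_pow q (- 1)"
    using of_int_in_Zp[of "- 1"] of_int_in_Zp[of "int _"]
    by (intro continuous_on_tendsto_compose[OF continuous_on_padic_pow]) auto
  then show "(\<lambda>N. q ^ (p ^ N - 1)) \<longlonglongrightarrow> padic_pow q (- 1)"
    by (simp only: padic_pow_of_nat)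
  have "(\<lambda>N. inverse q * q ^ p ^ N) \<longlonglongrightarrow> inverse q * 1"
    by (intro tendsto_cmult q_power_p_power_tendsto_1)
  moreover have "inverse q * q ^ p ^ N = q ^ (p ^ N - 1)" for N
    using p_power[of N] q_nonzero by (simp add: power_diff field_simps)
  ultimately show "(\<lambda>N. q ^ (p ^ N - 1)) \<longlonglongrightarrow> inverse q"
    by simp
qed

lemma q_number_of_nat: "q_number q (of_nat m) = (1 - q ^ m) / (1 - q)"
  by (simp add: q_number_def padic_pow_of_nat)

lemma q_number_inv_one_minus_of_nat:
  assumes "q \<noteq> 1"
  shows "q_number_inv q (1 - of_nat m) = 1 - q_number q (of_nat m)"
proof -
  have "padic_pow q (of_nat m - 1) = q ^ m / q"
  proof (cases m)
    case 0
    then show ?thesis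
      by (simp add: padic_pow_minus_1 inverse_eq_divide)
  next
    case (Suc m')
    then show ?thesis
      using q_nonzero by (simp add: padic_pow_of_nat)
  qed
  then have "q_number_inv q (1 - of_nat m) = (1 - q ^ m / q) / (1 - inverse q)"
    by (simp add: q_number_inv_def)
  also have "\<dots> = (q - q ^ m) / (q - 1)"
    using q_nonzero assms by (simp add: divide_simps)
  also have "\<dots> = 1 - q_number q (of_nat m)"
    using assms by (simp add: q_number_of_nat divide_simps) (simp add: algebra_simps)
  finally show ?thesis .
qed

section \<open>Riemann sums\<close>

lemma q_riemann_sum_linear_combination:
  assumes "\<And>m. f (of_nat m) = (\<Sum>i\<in>A. c i * g i (of_nat m))"
  shows "q_riemann_sum p q f N = (\<Sum>i\<in>A. c i * q_riemann_sum p q (g i) N)"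
proof -
  have "(\<Sum>x<p ^ N. f (of_nat x) * q ^ x) = (\<Sum>x<p ^ N. \<Sum>i\<in>A. c i * (g i (of_nat x) * q ^ x))"
    by (simp add: assms sum_distrib_right mult.assoc)
  also have "\<dots> = (\<Sum>i\<in>A. c i * (\<Sum>x<p ^ N. g i (of_nat x) * q ^ x))"
    by (subst sum.swap) (simp add: sum_distrib_left)
  finally show ?thesis
    by (simp add: q_riemann_sum_def sum_distrib_left mult.left_commute)
qed

text \<open>
  With \<open>t = q^(p^N)\<close>, the geometric sum has numerator \<open>t^(j+1) - 1\<close>. Its factor \<open>t - 1\<close> cancels
  against \<open>[p^N] = (1 - t) / (1 - q)\<close>, which removes the only term that tends to \<open>0\<close> in the
  denominator.
\<close>

lemma q_riemann_sum_padic_pow_power: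
  assumes "\<forall>m::nat. m > 0 \<longrightarrow> q ^ m \<noteq> 1"
  shows "q_riemann_sum p q (\<lambda>x. padic_pow q x ^ j) N =
    (\<Sum>i<Suc j. (1 - q) / (1 - q ^ Suc j) * (q ^ p ^ N) ^ i)"
proof -
  define t where "t = q ^ p ^ N"
  have neq: "t \<noteq> 1" "q ^ Suc j \<noteq> 1" "q \<noteq> 1"
    using assms[rule_format, of "p ^ N"] assms[rule_format, of "Suc j"] assms[rule_format, of 1]
      prime_gt_0_nat[OF prime_p] by (simp_all add: t_def)
  have "(\<Sum>x<p ^ N. padic_pow q (of_nat x) ^ j * q ^ x) = (\<Sum>x<p ^ N. (q ^ Suc j) ^ x)"
    by (simp add: padic_pow_of_nat power_mult_distrib mult.commute flip: power_mult)
  also have "\<dots> = ((q ^ Suc j) ^ p ^ N - 1) / (q ^ Suc j - 1)"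
    by (rule geometric_sum[OF neq(2)])
  also have "(q ^ Suc j) ^ p ^ N = t ^ Suc j"
    by (simp add: t_def mult.commute flip: power_mult power_Suc)
  also have "t ^ Suc j - 1 = (t - 1) * (\<Sum>i<Suc j. t ^ i)"
    by (rule power_diff_1_eq)
  finally have "q_riemann_sum p q (\<lambda>x. padic_pow q x ^ j) N =
      1 / ((1 - t) / (1 - q)) * ((t - 1) * (\<Sum>i<Suc j. t ^ i) / (q ^ Suc j - 1))"
    unfolding q_riemann_sum_def by (simp only: q_number_of_nat t_def)
  also have "\<dots> = (1 - q) / (1 - q ^ Suc j) * (\<Sum>i<Suc j. t ^ i)"
  proof -
    have "1 / ((1 - t) / (1 - q)) * ((t - 1) * s / (u - 1)) = (1 - q) / (1 - u) * s"
      if "u \<noteq> 1" for s u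
      using neq that by (simp add: divide_simps) (simp add: algebra_simps)
    then show ?thesis
      using neq(2) by blast
  qed
  finally show ?thesis
    unfolding t_def sum_distrib_left .
qed

lemma q_integrable_padic_pow_power:
  assumes "\<forall>m::nat. m > 0 \<longrightarrow> q ^ m \<noteq> 1"
  shows "q_integrable p q (\<lambda>x. padic_pow q x ^ j)"
  unfolding q_integrable_def convergent_def q_riemann_sum_padic_pow_power[OF assms]
  using tendsto_linear_combination[where f = "\<lambda>i N. (q ^ p ^ N) ^ i",
      OF q_power_mult_p_power_tendsto_1] by (rule exI)

lemma q_integral_linear_combination:
  assumes "\<And>m. f (of_nat m) = (\<Sum>i\<in>A. c i * g i (of_nat m))"
    and "\<And>i. i \<in> A \<Longrightarrow> q_integrable p q (g i)"
  shows "q_integrable p q f \<and> q_integral p q f = (\<Sum>i\<in>A. c i * q_integral p q (g i))"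
proof -
  have "(\<lambda>N. \<Sum>i\<in>A. c i * q_riemann_sum p q (g i) N) \<longlonglongrightarrow> (\<Sum>i\<in>A. c i * q_integral p q (g i))"
    using assms(2) unfolding q_integral_def q_integrable_def convergent_LIMSEQ_iff
    by (intro tendsto_linear_combination)
  moreover have "q_riemann_sum p q f = (\<lambda>N. \<Sum>i\<in>A. c i * q_riemann_sum p q (g i) N)"
    using q_riemann_sum_linear_combination[where f = f, OF assms(1)] by (rule ext)
  ultimately have "q_riemann_sum p q f \<longlonglongrightarrow> (\<Sum>i\<in>A. c i * q_integral p q (g i))"
    by simp
  then show ?thesis
    by (auto simp: q_integrable_def q_integral_def convergent_def limI)
qed

lemma q_integrable_q_number_power:
  assumes "\<forall>m::nat. m > 0 \<longrightarrow> q ^ m \<noteq> 1"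
  shows "q_integrable p q (\<lambda>x. q_number q x ^ n)"
proof -
  have "q_number q (of_nat m) ^ n =
      (\<Sum>j\<le>n. of_nat (n choose j) * (- 1) ^ j / (1 - q) ^ n * padic_pow q (of_nat m) ^ j)" for m
    by (simp add: q_number_def power_divide power_one_minus_expand sum_divide_distrib)
  from q_integral_linear_combination[where f = "\<lambda>x. q_number q x ^ n"
      and g = "\<lambda>j x. padic_pow q x ^ j", OF this q_integrable_padic_pow_power[OF assms]]
  show ?thesis ..
qed

lemma q_bernstein_of_nat:
  assumes "q \<noteq> 1"
  shows "q_bernstein k n (of_nat m) q =
    (\<Sum>l | l + k \<le> n. of_nat ((n - k) choose l) * of_nat (n choose k) * (- 1) ^ l
       * q_number q (of_nat m) ^ (l + k))"
proof (cases "k \<le> n")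
  case True
  then have "{l. l + k \<le> n} = {..n - k}"
    by auto
  then show ?thesis
    by (simp add: q_bernstein_def q_number_inv_one_minus_of_nat[OF assms] power_one_minus_expand
        sum_distrib_left power_add mult_ac)
next
  case False
  then have "{l. l + k \<le> n} = {}"
    by auto
  with False show ?thesis
    by (simp add: q_bernstein_def)
qed

end

section \<open>The integral of a Bernstein polynomial\<close>

theorem proposition1:
  fixes p :: nat and q :: "'a::{field_char_0,complete_space}" and n k :: nat
  assumes Cp: "padic_complex p TYPE('a)"
    and q_near_1: "pabs (1 - q) < 1"
    and q_not_root_of_unity: "\<forall>m::nat. m > 0 \<longrightarrow> q ^ m \<noteq> 1"
  shows "q_integrable p q (\<lambda>x. q_bernstein k n x q) \<and>
    q_integral p q (\<lambda>x. q_bernstein k n x q) =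
      (\<Sum>l | l + k \<le> n. of_nat ((n - k) choose l) * of_nat (n choose k) * (- 1) ^ l
         * carlitz_q_bernoulli p q (l + k))"
proof -
  interpret q_near_1 p q
    using Cp q_near_1 by unfold_locales (auto simp: padic_complex_def)
  have "q \<noteq> 1"
    using q_not_root_of_unity[rule_format, of 1] by simp
  then show ?thesis
    unfolding carlitz_q_bernoulli_def
    by (intro q_integral_linear_combination q_bernstein_of_nat
        q_integrable_q_number_power q_not_root_of_unity)
qed

end
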